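(* Let $P$ and $Q$ be partially ordered sets and $f\colon P\to Q$ an order embedding such that $f[P]$ is order dense in $Q$. Let $(x_\alpha)_{\alpha\in A}$ be a net in $P$ and $x\in P$. (i) If $Q$ is a Dedekind complete lattice, then $x_\alpha\xrightarrow{o_3}x$ implies $f(x_\alpha)\xrightarrow{o_2}f(x)$. (ii) If $P$ is a lattice, then $f(x_\alpha)\xrightarrow{o_2}f(x)$ implies $x_\alpha\xrightarrow{o_3}x$.
   Context: Nets are indexed by non-empty upward directed partially ordered sets. For a net in a partially ordered set $P$, $x_\alpha\downarrow x$ means that $x_\alpha\le x_\beta$ whenever $\alpha\ge\beta$ and $\inf_\alpha x_\alpha=x$; $x_\alpha\uparrow x$ is defined dually. $A_{\ge\alpha_0}:=\{\alpha\in A;\ \alpha\ge\alpha_0\}$. Order convergence in a partially ordered set $P$, for a net $(x_\alpha)_{\alpha\in A}$ in $P$ and $x\in P$: - $x_\alpha\xrightarrow{o_2}x$ if there are nets $(\hat x_\alpha)_{\alpha\in A}$, $(\check x_\alpha)_{\alpha\in A}$ in $P$ and $\alpha_0\in A$ with $\hat x_\alpha\uparrow x$, $\check x_\alpha\downarrow x$ and $\hat x_\alpha\le x_\alpha\le\check x_\alpha$ for all $\alpha\in A_{\ge\alpha_0}$. - $x_\alpha\xrightarrow{o_3}x$ if there are nets $(\hat x_\beta)_{\beta\in B}$, $(\check x_\gamma)_{\gamma\in C}$ in $P$ and a map $\eta\colon B\times C\to A$ with $\hat x_\beta\uparrow x$, $\check x_\gamma\downarrow x$ and $\hat x_\beta\le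 x_\alpha\le\check x_\gamma$ for all $\beta\in B$, $\gamma\in C$, $\alpha\in A_{\ge\eta(\beta,\gamma)}$. $f\colon P\to Q$ is an order embedding if for all $x,y\in P$: $x\le y$ if and only if $f(x)\le f(y)$. A subset $M\subseteq Q$ is order dense in $Q$ if for every $q\in Q$ one has $\sup\{m\in M;\ m\le q\}=q=\inf\{m\in M;\ m\ge q\}$ (taken in $Q$). A lattice is a partially ordered set in which every non-empty finite subset has a supremum and an infimum; it is Dedekind complete if every non-empty set bounded above has a supremum and every non-empty set bounded below has an infimum. *)

theory Defs
  imports "HOL-Library.Lub_Glb" "HOL-Library.FuncSet"
begin

text \<open>
  A partially ordered set is a type of class \<open>order\<close>; suprema and infima are
  taken in the whole type, \<open>isLub UNIV\<close> and \<open>isGlb UNIV\<close>. Index sets of nets are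
  carrier sets \<open>A\<close> with an explicit order relation \<open>r\<close>, where \<open>(\<alpha>, \<beta>) \<in> r\<close> means
  \<open>\<alpha> \<le> \<beta>\<close>. Values of a net outside its index set are irrelevant.
\<close>

definition directed_poset :: "'i set \<Rightarrow> 'i rel \<Rightarrow> bool" where
  "directed_poset A r \<longleftrightarrow>
     A \<noteq> {} \<and> partial_order_on A r \<and>
     (\<forall>\<alpha>\<in>A. \<forall>\<beta>\<in>A. \<exists>\<gamma>\<in>A. (\<alpha>, \<gamma>) \<in> r \<and> (\<beta>, \<gamma>) \<in> r)"

definition net_up :: "'i set \<Rightarrow> 'i rel \<Rightarrow> ('i \<Rightarrow> 'a::order) \<Rightarrow> 'a \<Rightarrow> bool" where
  "net_up A r u x \<longleftrightarrow>
     (\<forall>\<alpha>\<in>A. \<forall>\<beta>\<in>A. (\<beta>, \<alpha>) \<in> r \<longrightarrow> u \<beta> \<le> u \<alpha>) \<and> isLub UNIV (u ` A) x"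

definition net_down :: "'i set \<Rightarrow> 'i rel \<Rightarrow> ('i \<Rightarrow> 'a::order) \<Rightarrow> 'a \<Rightarrow> bool" where
  "net_down A r v x \<longleftrightarrow>
     (\<forall>\<alpha>\<in>A. \<forall>\<beta>\<in>A. (\<beta>, \<alpha>) \<in> r \<longrightarrow> v \<alpha> \<le> v \<beta>) \<and> isGlb UNIV (v ` A) x"

definition o2_conv :: "'i set \<Rightarrow> 'i rel \<Rightarrow> ('i \<Rightarrow> 'a::order) \<Rightarrow> 'a \<Rightarrow> bool" where
  "o2_conv A r xs x \<longleftrightarrow>
     (\<exists>u v. \<exists>\<alpha>\<^sub>0\<in>A. net_up A r u x \<and> net_down A r v x \<and>
        (\<forall>\<alpha>\<in>A. (\<alpha>\<^sub>0, \<alpha>) \<in> r \<longrightarrow> u \<alpha> \<le> xs \<alpha> \<and> xs \<alpha> \<le> v \<alpha>))"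

text \<open>
  HOL cannot quantify existentially over the types of the index sets \<open>B\<close> and \<open>C\<close>;
  they are taken as sets of elements of type \<open>'a\<close>, with arbitrary directed orders
  unrelated to that of \<open>'a\<close>. This loses nothing: by \<open>o3_convI\<close> below, index sets
  of any other types yield the same notion.
\<close>

definition o3_conv :: "'i set \<Rightarrow> 'i rel \<Rightarrow> ('i \<Rightarrow> 'a::order) \<Rightarrow> 'a \<Rightarrow> bool" where
  "o3_conv A r xs x \<longleftrightarrow>
     (\<exists>(B :: 'a set) s (C :: 'a set) t u v \<eta>.
        directed_poset B s \<and> directed_poset C t \<and>
        net_up B s u x \<and> net_down C t v x \<and> \<eta> \<in> B \<times> C \<rightarrow> A \<and>
        (\<forall>\<beta>\<in>B. \<forall>\<gamma>\<in>C. \<forall>\<alpha>\<in>A. (\<eta> (\<beta>, \<gamma>), \<alpha>) \<in> r \<longrightarrow> u \<beta> \<le> xs \<alpha> \<and> xs \<alpha> \<le> v \<gamma>))"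

definition order_embedding :: "('a::order \<Rightarrow> 'b::order) \<Rightarrow> bool" where
  "order_embedding f \<longleftrightarrow> (\<forall>x y. x \<le> y \<longleftrightarrow> f x \<le> f y)"

definition order_dense :: "'a::order set \<Rightarrow> bool" where
  "order_dense M \<longleftrightarrow>
     (\<forall>q. isLub UNIV {m\<in>M. m \<le> q} q \<and> isGlb UNIV {m\<in>M. q \<le> m} q)"

definition is_lattice :: "'a::order itself \<Rightarrow> bool" where
  "is_lattice _ \<longleftrightarrow>
     (\<forall>F :: 'a set. finite F \<and> F \<noteq> {} \<longrightarrow> (\<exists>s. isLub UNIV F s) \<and> (\<exists>i. isGlb UNIV F i))"

definition is_dedekind_complete_lattice :: "'a::order itself \<Rightarrow> bool" where
  "is_dedekind_complete_lattice T \<longleftrightarrow>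
     is_lattice T \<and>
     (\<forall>S :: 'a set. S \<noteq> {} \<and> bdd_above S \<longrightarrow> (\<exists>s. isLub UNIV S s)) \<and>
     (\<forall>S :: 'a set. S \<noteq> {} \<and> bdd_below S \<longrightarrow> (\<exists>i. isGlb UNIV S i))"

lemma net_up_range:
  fixes u :: "'b \<Rightarrow> 'a::order"
  assumes "directed_poset B s" "net_up B s u x"
  defines "R \<equiv> {(a, b). a \<in> u ` B \<and> b \<in> u ` B \<and> a \<le> b}"
  shows "directed_poset (u ` B) R" "net_up (u ` B) R (\<lambda>a. a) x"
proof -
  have po: "partial_order_on (u ` B) R"
    by (auto simp: R_def order_on_defs refl_on_def trans_def antisym_def)
  have "\<exists>c\<in>u ` B. (a, c) \<in> R \<and> (b, c) \<in> R" if "a \<in> u ` B" "b \<in> u ` B" for a b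
  proof -
    from that obtain a' b' where ab: "a' \<in> B" "b' \<in> B" "a = u a'" "b = u b'" by auto
    with assms(1) obtain c' where "c' \<in> B" "(a', c') \<in> s" "(b', c') \<in> s"
      unfolding directed_poset_def by blast
    with ab assms(2) show ?thesis unfolding net_up_def R_def by auto
  qed
  with po assms(1) show "directed_poset (u ` B) R" by (auto simp: directed_poset_def)
  show "net_up (u ` B) R (\<lambda>a. a) x" using assms(2) by (auto simp: net_up_def R_def)
qed

lemma net_down_range:
  fixes v :: "'c \<Rightarrow> 'a::order"
  assumes "directed_poset C t" "net_down C t v x"
  defines "R \<equiv> {(a, b). a \<in> v ` C \<and> b \<in> v ` C \<and> b \<le> a}"
  shows "directed_poset (v ` C) R" "net_down (v ` C) R (\<lambda>a. a) x"
proof -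
  have po: "partial_order_on (v ` C) R"
    by (auto simp: R_def order_on_defs refl_on_def trans_def antisym_def)
  have "\<exists>c\<in>v ` C. (a, c) \<in> R \<and> (b, c) \<in> R" if "a \<in> v ` C" "b \<in> v ` C" for a b
  proof -
    from that obtain a' b' where ab: "a' \<in> C" "b' \<in> C" "a = v a'" "b = v b'" by auto
    with assms(1) obtain c' where "c' \<in> C" "(a', c') \<in> t" "(b', c') \<in> t"
      unfolding directed_poset_def by blast
    with ab assms(2) show ?thesis unfolding net_down_def R_def by auto
  qed
  with po assms(1) show "directed_poset (v ` C) R" by (auto simp: directed_poset_def)
  show "net_down (v ` C) R (\<lambda>a. a) x" using assms(2) by (auto simp: net_down_def R_def)
qed

lemma o3_convI:
  fixes B :: "'b set" and C :: "'c set" and xs :: "'i \<Rightarrow> 'a::order"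
  assumes B: "directed_poset B s" "net_up B s u x"
    and C: "directed_poset C t" "net_down C t v x"
    and \<eta>: "\<eta> \<in> B \<times> C \<rightarrow> A"
    and bnd: "\<And>\<beta> \<gamma> \<alpha>. \<beta> \<in> B \<Longrightarrow> \<gamma> \<in> C \<Longrightarrow> \<alpha> \<in> A \<Longrightarrow> (\<eta> (\<beta>, \<gamma>), \<alpha>) \<in> r \<Longrightarrow>
      u \<beta> \<le> xs \<alpha> \<and> xs \<alpha> \<le> v \<gamma>"
  shows "o3_conv A r xs x"
proof -
  define \<eta>' where "\<eta>' = (\<lambda>(b, c). \<eta> (inv_into B u b, inv_into C v c))"
  have 1: "\<eta>' \<in> u ` B \<times> v ` C \<rightarrow> A"
  proof (rule Pi_I)
    fix p assume "p \<in> u ` B \<times> v ` C"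
    then obtain b c where p: "p = (b, c)" "b \<in> u ` B" "c \<in> v ` C" by blast
    then have "(inv_into B u b, inv_into C v c) \<in> B \<times> C" by (simp add: inv_into_into)
    then show "\<eta>' p \<in> A" using \<eta> p(1) by (auto simp: \<eta>'_def)
  qed
  have 2: "b \<le> xs \<alpha> \<and> xs \<alpha> \<le> c"
    if "b \<in> u ` B" "c \<in> v ` C" "\<alpha> \<in> A" "(\<eta>' (b, c), \<alpha>) \<in> r" for b c \<alpha>
    using bnd[of "inv_into B u b" "inv_into C v c" \<alpha>] that
    by (simp add: \<eta>'_def inv_into_into f_inv_into_f)
  show ?thesis
    unfolding o3_conv_def
    using net_up_range[OF B] net_down_range[OF C] 1 2 by blast
qed

end

theory Submission
  imports Defs
begin

text \<open>
  An order embedding with order dense range preserves existing suprema and infima, so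
  \<open>o\<^sub>3\<close>-convergence passes from \<open>P\<close> to \<open>Q\<close>. In a Dedekind complete lattice the bounding nets
  of an \<open>o\<^sub>3\<close>-convergent net can be reindexed by \<open>A\<close>: at \<open>\<alpha>\<close> take the supremum of all lower
  bounds \<open>u \<beta>\<close> already valid from \<open>\<alpha>\<close> on, together with one fixed \<open>u \<beta>\<^sub>0\<close> so that the set is
  never empty. Conversely, given bounding nets \<open>u\<close> and \<open>v\<close> in \<open>Q\<close>, the set of all \<open>p\<close>
  with \<open>f p \<le> u \<alpha>\<close> for some \<open>\<alpha>\<close> is directed upwards because \<open>P\<close> is a lattice, and by
  density it has supremum \<open>x\<close>; dually for \<open>v\<close>.
\<close>

section \<open>Suprema and infima under order embeddings with order dense range\<close>

lemma isLub_UNIV_iff: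
  "isLub UNIV S (x::'a::order) \<longleftrightarrow> (\<forall>s\<in>S. s \<le> x) \<and> (\<forall>y. (\<forall>s\<in>S. s \<le> y) \<longrightarrow> x \<le> y)"
  by (auto simp: isLub_def leastP_def isUb_def setle_def setge_def)

lemma isGlb_UNIV_iff:
  "isGlb UNIV S (x::'a::order) \<longleftrightarrow> (\<forall>s\<in>S. x \<le> s) \<and> (\<forall>y. (\<forall>s\<in>S. y \<le> s) \<longrightarrow> y \<le> x)"
  by (auto simp: isGlb_def greatestP_def isLb_def setle_def setge_def)

lemma order_dense_leI_below:
  assumes "order_dense M" "\<And>m. m \<in> M \<Longrightarrow> m \<le> q \<Longrightarrow> m \<le> y"
  shows "q \<le> y"
  using assms unfolding order_dense_def isLub_UNIV_iff by blast

lemma order_dense_leI_above: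
  assumes "order_dense M" "\<And>m. m \<in> M \<Longrightarrow> q \<le> m \<Longrightarrow> y \<le> m"
  shows "y \<le> q"
  using assms unfolding order_dense_def isGlb_UNIV_iff by blast

text \<open>An upper bound \<open>q\<close> of the image need not lie in the range of
  \<open>f\<close>. By density it is the infimum of the elements \<open>f p\<close> above it; each
  such \<open>p\<close> bounds \<open>S\<close> because \<open>f\<close> reflects the order, hence
  \<open>x \<le> p\<close>.\<close>

lemma order_embedding_isLub_image:
  assumes "order_embedding f" "order_dense (range f)" "isLub UNIV S x"
  shows "isLub UNIV (f ` S) (f x)"
proof -
  have "f x \<le> q" if "\<forall>s\<in>S. f s \<le> q" for q
  proof (rule order_dense_leI_above[OF assms(2)])
    fix m assume "m \<in> range f" "q \<le> m"
    then obtain p where p: "m = f p" "q \<le> f p" by blast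
    then have "\<forall>s\<in>S. s \<le> p"
      using that assms(1) by (meson order_embedding_def order_trans)
    then show "f x \<le> m"
      using p(1) assms(1,3) unfolding order_embedding_def isLub_UNIV_iff by blast
  qed
  moreover have "f s \<le> f x" if "s \<in> S" for s
    using assms(1,3) that unfolding order_embedding_def isLub_UNIV_iff by metis
  ultimately show ?thesis by (simp add: isLub_UNIV_iff)
qed

text \<open>Dually, a lower bound of the image is the supremum of the range elements below
  it.\<close>

lemma order_embedding_isGlb_image:
  assumes "order_embedding f" "order_dense (range f)" "isGlb UNIV S x"
  shows "isGlb UNIV (f ` S) (f x)"
proof -
  have "q \<le> f x" if "\<forall>s\<in>S. q \<le> f s" for q
  proof (rule order_dense_leI_below[OF assms(2)])
    fix m assume "m \<in> range f" "m \<le> q"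
    then obtain p where p: "m = f p" "f p \<le> q" by blast
    then have "\<forall>s\<in>S. p \<le> s"
      using that assms(1) by (meson order_embedding_def order_trans)
    then show "m \<le> f x"
      using p(1) assms(1,3) unfolding order_embedding_def isGlb_UNIV_iff by blast
  qed
  moreover have "f x \<le> f s" if "s \<in> S" for s
    using assms(1,3) that unfolding order_embedding_def isGlb_UNIV_iff by metis
  ultimately show ?thesis by (simp add: isGlb_UNIV_iff)
qed

lemma order_embedding_o3_conv:
  fixes f :: "'p::order \<Rightarrow> 'q::order"
  assumes "order_embedding f" "order_dense (range f)" "o3_conv A r xs x"
  shows "o3_conv A r (\<lambda>\<alpha>. f (xs \<alpha>)) (f x)"
proof -
  have mono: "p \<le> q \<Longrightarrow> f p \<le> f q" for p q
    using assms(1) unfolding order_embedding_def by blast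
  obtain B :: "'p set" and s and C :: "'p set" and t u v \<eta> where
      B: "directed_poset B s" "net_up B s u x"
    and C: "directed_poset C t" "net_down C t v x" and \<eta>: "\<eta> \<in> B \<times> C \<rightarrow> A"
    and bnd: "\<forall>\<beta>\<in>B. \<forall>\<gamma>\<in>C. \<forall>\<alpha>\<in>A. (\<eta> (\<beta>, \<gamma>), \<alpha>) \<in> r \<longrightarrow> u \<beta> \<le> xs \<alpha> \<and> xs \<alpha> \<le> v \<gamma>"
    using assms(3) unfolding o3_conv_def by - (elim exE conjE, rule that, assumption+)
  have "net_up B s (\<lambda>\<beta>. f (u \<beta>)) (f x)"
    using B(2) mono order_embedding_isLub_image[OF assms(1,2), of "u ` B"]
    by (auto simp: net_up_def image_image)
  moreover have "net_down C t (\<lambda>\<gamma>. f (v \<gamma>)) (f x)"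
    using C(2) mono order_embedding_isGlb_image[OF assms(1,2), of "v ` C"]
    by (auto simp: net_down_def image_image)
  \<comment> \<open>The index sets and \<eta> stay the same. They live in \<open>'p\<close>, while
    convergence to \<open>f x\<close> asks for index sets in \<open>'q\<close>, so the change of
    type goes through \<open>o3_convI\<close>.\<close>
  ultimately show ?thesis
    using bnd mono by (intro o3_convI[OF B(1) _ C(1) _ \<eta>]) blast+
qed

section \<open>Reindexing bounding nets in a Dedekind complete lattice\<close>

text \<open>\<open>V \<beta> \<alpha>\<close> is to be read as: \<open>u \<beta>\<close> is a valid
  lower bound from \<alpha> on. Validity persists by \<open>mono\<close> and is reached somewhere in
  \<open>A\<close> by \<open>cofinal\<close>. The second property of \<open>w\<close> is the
  leastness of the supremum from which \<open>w \<alpha>\<close> is built.\<close>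

lemma net_up_reindex:
  fixes u :: "'b \<Rightarrow> 'a::order"
  assumes dc: "is_dedekind_complete_lattice TYPE('a)"
    and lub: "isLub UNIV (u ` B) x" and "\<beta>\<^sub>0 \<in> B"
    and cofinal: "\<And>\<beta>. \<beta> \<in> B \<Longrightarrow> \<exists>\<alpha>\<in>A. V \<beta> \<alpha>"
    and mono: "\<And>\<beta> \<alpha> \<alpha>'. V \<beta> \<alpha> \<Longrightarrow> (\<alpha>, \<alpha>') \<in> r \<Longrightarrow> V \<beta> \<alpha>'"
  obtains w where "net_up A r w x"
    "\<And>\<alpha> y. u \<beta>\<^sub>0 \<le> y \<Longrightarrow> (\<And>\<beta>. \<beta> \<in> B \<Longrightarrow> V \<beta> \<alpha> \<Longrightarrow> u \<beta> \<le> y) \<Longrightarrow> w \<alpha> \<le> y"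
proof -
  \<comment> \<open>The index \<open>\<beta>\<^sub>0\<close> is a default: at a given \<alpha> no
    \<beta> need be valid, and completeness yields suprema of non-empty bounded sets only. The bound
    is \<open>x\<close>, for every \<alpha>.\<close>
  define S where "S \<alpha> = u ` {\<beta>\<in>B. \<beta> = \<beta>\<^sub>0 \<or> V \<beta> \<alpha>}" for \<alpha>
  have le_x: "\<forall>a\<in>S \<alpha>. a \<le> x" for \<alpha>
    using lub by (auto simp: S_def isLub_UNIV_iff)
  have "\<exists>w. isLub UNIV (S \<alpha>) w" for \<alpha>
  proof -
    have "bdd_above (S \<alpha>)" using le_x by (auto simp: bdd_above_def)
    moreover have "S \<alpha> \<noteq> {}" using \<open>\<beta>\<^sub>0 \<in> B\<close> by (auto simp: S_def)
    ultimately show ?thesis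
      using dc by (simp add: is_dedekind_complete_lattice_def)
  qed
  then obtain w where w: "isLub UNIV (S \<alpha>) (w \<alpha>)" for \<alpha> by metis
  have S_le: "a \<le> w \<alpha>" if "a \<in> S \<alpha>" for a \<alpha> using w that by (auto simp: isLub_UNIV_iff)
  have w_le: "w \<alpha> \<le> y" if "\<And>a. a \<in> S \<alpha> \<Longrightarrow> a \<le> y" for y \<alpha>
    using w that by (auto simp: isLub_UNIV_iff)
  \<comment> \<open>By \<open>mono\<close> the sets \<open>S \<alpha>\<close> grow with \<alpha>, so
    their suprema increase.\<close>
  have up: "w \<alpha> \<le> w \<alpha>'" if "(\<alpha>, \<alpha>') \<in> r" for \<alpha> \<alpha>'
    using that mono by (intro w_le S_le) (auto simp: S_def)
  \<comment> \<open>Each \<open>u \<beta>\<close> enters some \<open>S \<alpha>\<close> with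
    \<alpha> in \<open>A\<close>, so a bound of all these \<open>w \<alpha>\<close> bounds the whole
    original net.\<close>
  have "x \<le> y" if y: "\<And>\<alpha>. \<alpha> \<in> A \<Longrightarrow> w \<alpha> \<le> y" for y
  proof -
    have "u \<beta> \<le> y" if "\<beta> \<in> B" for \<beta>
    proof -
      obtain \<alpha> where "\<alpha> \<in> A" "V \<beta> \<alpha>" using cofinal \<open>\<beta> \<in> B\<close> by blast
      then show ?thesis
        using y[of \<alpha>] S_le[of "u \<beta>" \<alpha>] that by (force simp: S_def)
    qed
    then show ?thesis using lub by (auto simp: isLub_UNIV_iff)
  qed
  then have "net_up A r w x"
    using up w_le le_x by (auto simp: net_up_def isLub_UNIV_iff)
  then show thesis
  proof (rule that)
    fix \<alpha> y assume "u \<beta>\<^sub>0 \<le> y" "\<And>\<beta>. \<beta> \<in> B \<Longrightarrow> V \<beta> \<alpha> \<Longrightarrow> u \<beta> \<le> y"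
    then show "w \<alpha> \<le> y" by (intro w_le) (unfold S_def, blast)
  qed
qed

text \<open>Order dual of \<open>net_up_reindex\<close>: the sets \<open>S \<alpha>\<close> still
  grow with \<alpha>, so their infima decrease.\<close>

lemma net_down_reindex:
  fixes v :: "'b \<Rightarrow> 'a::order"
  assumes dc: "is_dedekind_complete_lattice TYPE('a)"
    and glb: "isGlb UNIV (v ` B) x" and "\<beta>\<^sub>0 \<in> B"
    and cofinal: "\<And>\<beta>. \<beta> \<in> B \<Longrightarrow> \<exists>\<alpha>\<in>A. V \<beta> \<alpha>"
    and mono: "\<And>\<beta> \<alpha> \<alpha>'. V \<beta> \<alpha> \<Longrightarrow> (\<alpha>, \<alpha>') \<in> r \<Longrightarrow> V \<beta> \<alpha>'"
  obtains w where "net_down A r w x"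
    "\<And>\<alpha> y. y \<le> v \<beta>\<^sub>0 \<Longrightarrow> (\<And>\<beta>. \<beta> \<in> B \<Longrightarrow> V \<beta> \<alpha> \<Longrightarrow> y \<le> v \<beta>) \<Longrightarrow> y \<le> w \<alpha>"
proof -
  define S where "S \<alpha> = v ` {\<beta>\<in>B. \<beta> = \<beta>\<^sub>0 \<or> V \<beta> \<alpha>}" for \<alpha>
  have x_le: "\<forall>a\<in>S \<alpha>. x \<le> a" for \<alpha>
    using glb by (auto simp: S_def isGlb_UNIV_iff)
  have "\<exists>w. isGlb UNIV (S \<alpha>) w" for \<alpha>
  proof -
    have "bdd_below (S \<alpha>)" using x_le by (auto simp: bdd_below_def)
    moreover have "S \<alpha> \<noteq> {}" using \<open>\<beta>\<^sub>0 \<in> B\<close> by (auto simp: S_def)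
    ultimately show ?thesis
      using dc by (simp add: is_dedekind_complete_lattice_def)
  qed
  then obtain w where w: "isGlb UNIV (S \<alpha>) (w \<alpha>)" for \<alpha> by metis
  have le_S: "w \<alpha> \<le> a" if "a \<in> S \<alpha>" for a \<alpha> using w that by (auto simp: isGlb_UNIV_iff)
  have le_w: "y \<le> w \<alpha>" if "\<And>a. a \<in> S \<alpha> \<Longrightarrow> y \<le> a" for y \<alpha>
    using w that by (auto simp: isGlb_UNIV_iff)
  have down: "w \<alpha>' \<le> w \<alpha>" if "(\<alpha>, \<alpha>') \<in> r" for \<alpha> \<alpha>'
    using that mono by (intro le_w le_S) (auto simp: S_def)
  have "y \<le> x" if y: "\<And>\<alpha>. \<alpha> \<in> A \<Longrightarrow> y \<le> w \<alpha>" for y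
  proof -
    have "y \<le> v \<beta>" if "\<beta> \<in> B" for \<beta>
    proof -
      obtain \<alpha> where "\<alpha> \<in> A" "V \<beta> \<alpha>" using cofinal \<open>\<beta> \<in> B\<close> by blast
      then show ?thesis
        using y[of \<alpha>] le_S[of "v \<beta>" \<alpha>] that by (force simp: S_def)
    qed
    then show ?thesis using glb by (auto simp: isGlb_UNIV_iff)
  qed
  then have "net_down A r w x"
    using down le_w x_le by (auto simp: net_down_def isGlb_UNIV_iff)
  then show thesis
  proof (rule that)
    fix \<alpha> y assume "y \<le> v \<beta>\<^sub>0" "\<And>\<beta>. \<beta> \<in> B \<Longrightarrow> V \<beta> \<alpha> \<Longrightarrow> y \<le> v \<beta>"
    then show "y \<le> w \<alpha>" by (intro le_w) (unfold S_def, blast)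
  qed
qed

lemma o3_conv_imp_o2_conv:
  fixes xs :: "'i \<Rightarrow> 'a::order"
  assumes dc: "is_dedekind_complete_lattice TYPE('a)"
    and A: "directed_poset A r" and conv: "o3_conv A r xs x"
  shows "o2_conv A r xs x"
proof -
  obtain B :: "'a set" and s and C :: "'a set" and t u v \<eta> where
      B: "directed_poset B s" "net_up B s u x"
    and C: "directed_poset C t" "net_down C t v x" and \<eta>: "\<eta> \<in> B \<times> C \<rightarrow> A"
    and bnd: "\<forall>\<beta>\<in>B. \<forall>\<gamma>\<in>C. \<forall>\<alpha>\<in>A. (\<eta> (\<beta>, \<gamma>), \<alpha>) \<in> r \<longrightarrow> u \<beta> \<le> xs \<alpha> \<and> xs \<alpha> \<le> v \<gamma>"
    using conv unfolding o3_conv_def by - (elim exE conjE, rule that, assumption+)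
  have r: "refl_on A r" "trans r"
    using A by (auto simp: directed_poset_def order_on_defs)
  obtain \<beta>\<^sub>0 \<gamma>\<^sub>0 where 0: "\<beta>\<^sub>0 \<in> B" "\<gamma>\<^sub>0 \<in> C"
    using B(1) C(1) unfolding directed_poset_def by blast
  have \<eta>A: "\<eta> (\<beta>, \<gamma>) \<in> A" if "\<beta> \<in> B" "\<gamma> \<in> C" for \<beta> \<gamma>
    using \<eta> that by blast
  \<comment> \<open>The bound \<open>u \<beta> \<le> xs \<alpha>\<close> does not mention \<gamma>,
    so one \<gamma> with \<alpha> above \<open>\<eta> (\<beta>, \<gamma>)\<close> makes
    \<open>u \<beta>\<close> valid. Cofinality is witnessed by
    \<open>\<eta> (\<beta>, \<gamma>\<^sub>0)\<close> itself, by reflexivity.\<close>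
  obtain w where w: "net_up A r w x"
    "\<And>\<alpha> y. u \<beta>\<^sub>0 \<le> y \<Longrightarrow> (\<And>\<beta>. \<beta> \<in> B \<Longrightarrow> \<exists>\<gamma>\<in>C. (\<eta> (\<beta>, \<gamma>), \<alpha>) \<in> r \<Longrightarrow> u \<beta> \<le> y) \<Longrightarrow> w \<alpha> \<le> y"
  proof (rule net_up_reindex[OF dc, of u B x \<beta>\<^sub>0 A "\<lambda>\<beta> \<alpha>. \<exists>\<gamma>\<in>C. (\<eta> (\<beta>, \<gamma>), \<alpha>) \<in> r" r])
    show "isLub UNIV (u ` B) x" using B(2) by (simp add: net_up_def)
    show "\<exists>\<alpha>\<in>A. \<exists>\<gamma>\<in>C. (\<eta> (\<beta>, \<gamma>), \<alpha>) \<in> r" if "\<beta> \<in> B" for \<beta>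
      using \<eta>A[OF that 0(2)] refl_onD[OF r(1)] 0 by blast
  qed (use 0 r(2) in \<open>auto dest: transD\<close>)
  obtain w' where w': "net_down A r w' x"
    "\<And>\<alpha> y. y \<le> v \<gamma>\<^sub>0 \<Longrightarrow> (\<And>\<gamma>. \<gamma> \<in> C \<Longrightarrow> \<exists>\<beta>\<in>B. (\<eta> (\<beta>, \<gamma>), \<alpha>) \<in> r \<Longrightarrow> y \<le> v \<gamma>) \<Longrightarrow> y \<le> w' \<alpha>"
  proof (rule net_down_reindex[OF dc, of v C x \<gamma>\<^sub>0 A "\<lambda>\<gamma> \<alpha>. \<exists>\<beta>\<in>B. (\<eta> (\<beta>, \<gamma>), \<alpha>) \<in> r" r])
    show "isGlb UNIV (v ` C) x" using C(2) by (simp add: net_down_def)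
    show "\<exists>\<alpha>\<in>A. \<exists>\<beta>\<in>B. (\<eta> (\<beta>, \<gamma>), \<alpha>) \<in> r" if "\<gamma> \<in> C" for \<gamma>
      using \<eta>A[OF 0(1) that] refl_onD[OF r(1)] 0 by blast
  qed (use 0 r(2) in \<open>auto dest: transD\<close>)
  \<comment> \<open>Above \<open>\<eta> (\<beta>\<^sub>0, \<gamma>\<^sub>0)\<close> the defaults are
    valid bounds too, so \<open>xs \<alpha>\<close> lies between all elements whose supremum and
    infimum were taken. This index serves as the \<open>\<alpha>\<^sub>0\<close> of
    \<open>o2_conv\<close>.\<close>
  have "w \<alpha> \<le> xs \<alpha> \<and> xs \<alpha> \<le> w' \<alpha>" if "\<alpha> \<in> A" "(\<eta> (\<beta>\<^sub>0, \<gamma>\<^sub>0), \<alpha>) \<in> r" for \<alpha>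
    using that bnd 0 by (intro conjI w(2) w'(2)) blast+
  then show ?thesis
    unfolding o2_conv_def using w(1) w'(1) \<eta>A[OF 0] by blast
qed

section \<open>Pulling bounding nets back along the embedding\<close>

text \<open>The values \<open>u \<alpha>\<close> may lie outside the range of \<open>f\<close>, so
  each is replaced by the elements of \<open>P\<close> whose images lie below it. The resulting set
  indexes itself, with the order of \<open>P\<close>.\<close>

lemma net_up_preimage:
  fixes f :: "'p::order \<Rightarrow> 'q::order"
  assumes emb: "order_embedding f" and dense: "order_dense (range f)"
    and lat: "is_lattice TYPE('p)" and A: "directed_poset A r" and u: "net_up A r u (f x)"
  defines "B \<equiv> {p. \<exists>\<alpha>\<in>A. f p \<le> u \<alpha>}"
  defines "s \<equiv> {(a, b). a \<in> B \<and> b \<in> B \<and> a \<le> b}"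
  shows "directed_poset B s" "net_up B s (\<lambda>p. p) x"
proof -
  have emb_iff: "f p \<le> f q \<longleftrightarrow> p \<le> q" for p q
    using emb by (auto simp: order_embedding_def)
  have u_le: "u \<alpha> \<le> f x" if "\<alpha> \<in> A" for \<alpha>
    using u that by (auto simp: net_up_def isLub_UNIV_iff)
  \<comment> \<open>By density \<open>u \<alpha>\<close> is the supremum of images of elements of
    \<open>B\<close>. So if \<open>y\<close> bounds \<open>B\<close>, then \<open>f y\<close> bounds
    every \<open>u \<alpha>\<close> and hence \<open>f x\<close>.\<close>
  have x_le: "x \<le> y" if "\<And>p. p \<in> B \<Longrightarrow> p \<le> y" for y
  proof -
    have "u \<alpha> \<le> f y" if "\<alpha> \<in> A" for \<alpha>
    proof (rule order_dense_leI_below[OF dense])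
      fix m assume "m \<in> range f" "m \<le> u \<alpha>"
      then show "m \<le> f y"
        using \<open>\<alpha> \<in> A\<close> \<open>\<And>p. p \<in> B \<Longrightarrow> p \<le> y\<close> unfolding B_def mem_Collect_eq
        by (metis emb_iff rangeE)
    qed
    then show ?thesis
      using u by (simp add: net_up_def isLub_UNIV_iff flip: emb_iff)
  qed
  have B_le: "p \<le> x" if "p \<in> B" for p
  proof -
    obtain \<alpha> where "\<alpha> \<in> A" "f p \<le> u \<alpha>" using \<open>p \<in> B\<close> unfolding B_def by blast
    then show ?thesis using u_le[of \<alpha>] order_trans[of "f p"] by (simp flip: emb_iff)
  qed
  then show "net_up B s (\<lambda>p. p) x"
    using x_le by (auto simp: net_up_def isLub_UNIV_iff s_def)
  have nonempty: "B \<noteq> {}"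
  proof
    assume "B = {}"
    \<comment> \<open>Then \<open>x\<close> is the least element of \<open>P\<close>, so by density every \<open>u \<alpha>\<close> is above \<open>f x\<close>.\<close>
    then have least: "x \<le> y" for y using x_le by blast
    obtain \<alpha> where "\<alpha> \<in> A" using A unfolding directed_poset_def by blast
    have "f x \<le> u \<alpha>"
      by (rule order_dense_leI_above[OF dense]) (auto simp: emb_iff least)
    then show False using \<open>B = {}\<close> \<open>\<alpha> \<in> A\<close> unfolding B_def by blast
  qed
  have "\<exists>c\<in>B. a \<le> c \<and> b \<le> c" if ab: "a \<in> B" "b \<in> B" for a b
  proof -
    obtain \<alpha> \<beta> where "\<alpha> \<in> A" "\<beta> \<in> A" and le: "f a \<le> u \<alpha>" "f b \<le> u \<beta>"
      using ab by (auto simp: B_def)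
    then obtain \<gamma> where \<gamma>: "\<gamma> \<in> A" "(\<alpha>, \<gamma>) \<in> r" "(\<beta>, \<gamma>) \<in> r"
      using A unfolding directed_poset_def by blast
    then have "u \<alpha> \<le> u \<gamma>" "u \<beta> \<le> u \<gamma>"
      using u \<open>\<alpha> \<in> A\<close> \<open>\<beta> \<in> A\<close> by (auto simp: net_up_def)
    then have "f a \<le> u \<gamma>" "f b \<le> u \<gamma>" using le by order+
    \<comment> \<open>The join \<open>c\<close> is taken in \<open>P\<close>, while
      \<open>u \<gamma>\<close> is only in \<open>Q\<close>. Since \<open>f\<close> preserves this
      supremum, \<open>f c\<close> is the least upper bound of \<open>f a\<close> and
      \<open>f b\<close> in \<open>Q\<close>, so it stays below \<open>u \<gamma>\<close>.\<close>
    moreover obtain c where c: "isLub UNIV {a, b} c"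
      using lat unfolding is_lattice_def by (metis finite.simps insert_not_empty)
    ultimately have "f c \<le> u \<gamma>"
      using order_embedding_isLub_image[OF emb dense c] by (auto simp: isLub_UNIV_iff)
    then show ?thesis using c \<gamma>(1) by (auto simp: B_def isLub_UNIV_iff)
  qed
  then show "directed_poset B s"
    using nonempty
    by (auto simp: directed_poset_def s_def order_on_defs refl_on_def trans_def antisym_def)
qed

text \<open>Order dual of \<open>net_up_preimage\<close>; \<open>t\<close> reverses the order of
  \<open>P\<close>, so that the identity becomes a decreasing net.\<close>

lemma net_down_preimage:
  fixes f :: "'p::order \<Rightarrow> 'q::order"
  assumes emb: "order_embedding f" and dense: "order_dense (range f)"
    and lat: "is_lattice TYPE('p)" and A: "directed_poset A r" and v: "net_down A r v (f x)"
  defines "C \<equiv> {p. \<exists>\<alpha>\<in>A. v \<alpha> \<le> f p}"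
  defines "t \<equiv> {(a, b). a \<in> C \<and> b \<in> C \<and> b \<le> a}"
  shows "directed_poset C t" "net_down C t (\<lambda>p. p) x"
proof -
  have emb_iff: "f p \<le> f q \<longleftrightarrow> p \<le> q" for p q
    using emb by (auto simp: order_embedding_def)
  have le_v: "f x \<le> v \<alpha>" if "\<alpha> \<in> A" for \<alpha>
    using v that by (auto simp: net_down_def isGlb_UNIV_iff)
  have le_x: "y \<le> x" if "\<And>p. p \<in> C \<Longrightarrow> y \<le> p" for y
  proof -
    have "f y \<le> v \<alpha>" if "\<alpha> \<in> A" for \<alpha>
    proof (rule order_dense_leI_above[OF dense])
      fix m assume "m \<in> range f" "v \<alpha> \<le> m"
      then show "f y \<le> m"
        using \<open>\<alpha> \<in> A\<close> \<open>\<And>p. p \<in> C \<Longrightarrow> y \<le> p\<close> unfolding C_def mem_Collect_eq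
        by (metis emb_iff rangeE)
    qed
    then show ?thesis
      using v by (simp add: net_down_def isGlb_UNIV_iff flip: emb_iff)
  qed
  have le_C: "x \<le> p" if "p \<in> C" for p
  proof -
    obtain \<alpha> where "\<alpha> \<in> A" "v \<alpha> \<le> f p" using \<open>p \<in> C\<close> unfolding C_def by blast
    then show ?thesis using le_v[of \<alpha>] order_trans[of "f x"] by (simp flip: emb_iff)
  qed
  then show "net_down C t (\<lambda>p. p) x"
    using le_x by (auto simp: net_down_def isGlb_UNIV_iff t_def)
  \<comment> \<open>If \<open>C\<close> were empty, \<open>x\<close> would be the greatest element
    of \<open>P\<close>; by density every \<open>v \<alpha>\<close> would lie below
    \<open>f x\<close>, which puts \<open>x\<close> into \<open>C\<close>.\<close>
  have nonempty: "C \<noteq> {}"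
  proof
    assume "C = {}"
    then have greatest: "y \<le> x" for y using le_x by blast
    obtain \<alpha> where "\<alpha> \<in> A" using A unfolding directed_poset_def by blast
    have "v \<alpha> \<le> f x"
      by (rule order_dense_leI_below[OF dense]) (auto simp: emb_iff greatest)
    then show False using \<open>C = {}\<close> \<open>\<alpha> \<in> A\<close> unfolding C_def by blast
  qed
  have "\<exists>c\<in>C. c \<le> a \<and> c \<le> b" if ab: "a \<in> C" "b \<in> C" for a b
  proof -
    obtain \<alpha> \<beta> where "\<alpha> \<in> A" "\<beta> \<in> A" and le: "v \<alpha> \<le> f a" "v \<beta> \<le> f b"
      using ab by (auto simp: C_def)
    then obtain \<gamma> where \<gamma>: "\<gamma> \<in> A" "(\<alpha>, \<gamma>) \<in> r" "(\<beta>, \<gamma>) \<in> r"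
      using A unfolding directed_poset_def by blast
    then have "v \<gamma> \<le> v \<alpha>" "v \<gamma> \<le> v \<beta>"
      using v \<open>\<alpha> \<in> A\<close> \<open>\<beta> \<in> A\<close> by (auto simp: net_down_def)
    then have "v \<gamma> \<le> f a" "v \<gamma> \<le> f b" using le by order+
    moreover obtain c where c: "isGlb UNIV {a, b} c"
      using lat unfolding is_lattice_def by (metis finite.simps insert_not_empty)
    ultimately have "v \<gamma> \<le> f c"
      using order_embedding_isGlb_image[OF emb dense c] by (auto simp: isGlb_UNIV_iff)
    then show ?thesis using c \<gamma>(1) by (auto simp: C_def isGlb_UNIV_iff)
  qed
  then show "directed_poset C t"
    using nonempty
    by (auto simp: directed_poset_def t_def order_on_defs refl_on_def trans_def antisym_def)
qed

lemma order_embedding_o2_conv_imp_o3_conv: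
  fixes f :: "'p::order \<Rightarrow> 'q::order"
  assumes emb: "order_embedding f" and dense: "order_dense (range f)"
    and lat: "is_lattice TYPE('p)" and A: "directed_poset A r"
    and conv: "o2_conv A r (\<lambda>\<alpha>. f (xs \<alpha>)) (f x)"
  shows "o3_conv A r xs x"
proof -
  have emb_iff: "f p \<le> f q \<longleftrightarrow> p \<le> q" for p q
    using emb by (auto simp: order_embedding_def)
  obtain u v \<alpha>\<^sub>0 where \<alpha>\<^sub>0: "\<alpha>\<^sub>0 \<in> A" and u: "net_up A r u (f x)" and v: "net_down A r v (f x)"
    and bnd: "\<And>\<alpha>. \<alpha> \<in> A \<Longrightarrow> (\<alpha>\<^sub>0, \<alpha>) \<in> r \<Longrightarrow> u \<alpha> \<le> f (xs \<alpha>) \<and> f (xs \<alpha>) \<le> v \<alpha>"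
    using conv unfolding o2_conv_def by blast
  have u_mono: "u \<alpha> \<le> u \<beta>" and v_mono: "v \<beta> \<le> v \<alpha>"
    if "\<alpha> \<in> A" "\<beta> \<in> A" "(\<alpha>, \<beta>) \<in> r" for \<alpha> \<beta>
    using u v that by (auto simp: net_up_def net_down_def)
  have "trans r" using A by (auto simp: directed_poset_def order_on_defs)
  define B where "B = {p. \<exists>\<alpha>\<in>A. f p \<le> u \<alpha>}"
  define C where "C = {p. \<exists>\<alpha>\<in>A. v \<alpha> \<le> f p}"
  \<comment> \<open>The index \<delta> lies above three others: the witnesses for \<open>b\<close>
    and \<open>c\<close>, and \<open>\<alpha>\<^sub>0\<close>, beyond which \<open>u\<close> and
    \<open>v\<close> enclose the net. A choice of \<delta> for each pair is the map \<eta>.\<close>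
  have "\<exists>\<delta>\<in>A. (\<alpha>\<^sub>0, \<delta>) \<in> r \<and> f b \<le> u \<delta> \<and> v \<delta> \<le> f c" if bc: "b \<in> B" "c \<in> C" for b c
  proof -
    obtain \<alpha> \<beta> where ab: "\<alpha> \<in> A" "\<beta> \<in> A" and le: "f b \<le> u \<alpha>" "v \<beta> \<le> f c"
      using bc by (auto simp: B_def C_def)
    then obtain \<gamma> where \<gamma>: "\<gamma> \<in> A" "(\<alpha>, \<gamma>) \<in> r" "(\<beta>, \<gamma>) \<in> r"
      using A unfolding directed_poset_def by blast
    then obtain \<delta> where \<delta>: "\<delta> \<in> A" "(\<gamma>, \<delta>) \<in> r" "(\<alpha>\<^sub>0, \<delta>) \<in> r"
      using A \<alpha>\<^sub>0 unfolding directed_poset_def by blast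
    have "(\<alpha>, \<delta>) \<in> r" "(\<beta>, \<delta>) \<in> r" using \<gamma> \<delta> \<open>trans r\<close> by (auto dest: transD)
    then show ?thesis
      using \<delta> le u_mono[OF ab(1) \<delta>(1)] v_mono[OF ab(2) \<delta>(1)] by (meson order_trans)
  qed
  then obtain \<eta> where \<eta>: "\<And>b c. b \<in> B \<Longrightarrow> c \<in> C \<Longrightarrow>
      \<eta> b c \<in> A \<and> (\<alpha>\<^sub>0, \<eta> b c) \<in> r \<and> f b \<le> u (\<eta> b c) \<and> v (\<eta> b c) \<le> f c"
    by metis
  note B_net = net_up_preimage[OF emb dense lat A u, folded B_def]
  note C_net = net_down_preimage[OF emb dense lat A v, folded C_def]
  show ?thesis
  proof (rule o3_convI[OF B_net C_net, where \<eta> = "\<lambda>(b, c). \<eta> b c"])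
    show "(\<lambda>(b, c). \<eta> b c) \<in> B \<times> C \<rightarrow> A" using \<eta> by auto
    fix b c \<alpha> assume bc: "b \<in> B" "c \<in> C" and \<alpha>: "\<alpha> \<in> A" "((\<lambda>(b, c). \<eta> b c) (b, c), \<alpha>) \<in> r"
    then have "(\<alpha>\<^sub>0, \<alpha>) \<in> r" using \<eta>[OF bc] \<open>trans r\<close> by (auto dest: transD)
    \<comment> \<open>Monotonicity of \<open>u\<close> and \<open>v\<close> carries the two
      inequalities from \<open>\<eta> b c\<close> to all later \<alpha>.\<close>
    moreover have "f b \<le> u \<alpha>" "v \<alpha> \<le> f c"
      using \<eta>[OF bc] \<alpha> u_mono[of "\<eta> b c" \<alpha>] v_mono[of "\<eta> b c" \<alpha>] by (auto intro: order_trans)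
    ultimately have "f b \<le> f (xs \<alpha>)" "f (xs \<alpha>) \<le> f c"
      using bnd[OF \<alpha>(1)] by (meson order_trans)+
    then show "b \<le> xs \<alpha> \<and> xs \<alpha> \<le> c" by (simp add: emb_iff)
  qed
qed

theorem proposition4p10:
  fixes f :: "'p::order \<Rightarrow> 'q::order"
    and A :: "'i set" and r :: "'i rel"
    and xs :: "'i \<Rightarrow> 'p" and x :: 'p
  assumes "order_embedding f"
    and "order_dense (range f)"
    and "directed_poset A r"
  shows "(is_dedekind_complete_lattice TYPE('q) \<longrightarrow>
            o3_conv A r xs x \<longrightarrow> o2_conv A r (\<lambda>\<alpha>. f (xs \<alpha>)) (f x)) \<and>
         (is_lattice TYPE('p) \<longrightarrow>
            o2_conv A r (\<lambda>\<alpha>. f (xs \<alpha>)) (f x) \<longrightarrow> o3_conv A r xs x)"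
proof (intro conjI impI)
  assume "is_dedekind_complete_lattice TYPE('q)" "o3_conv A r xs x"
  \<comment> \<open>Completeness is available only in \<open>Q\<close>, so the convergence is first
    transferred there and then strengthened.\<close>
  then show "o2_conv A r (\<lambda>\<alpha>. f (xs \<alpha>)) (f x)"
    by (intro o3_conv_imp_o2_conv[OF _ assms(3)] order_embedding_o3_conv[OF assms(1,2)])
next
  assume "is_lattice TYPE('p)" "o2_conv A r (\<lambda>\<alpha>. f (xs \<alpha>)) (f x)"
  then show "o3_conv A r xs x"
    by (rule order_embedding_o2_conv_imp_o3_conv[OF assms(1,2) _ assms(3)])
qed

end
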